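(* For all integers $i,j$ with $1\le i<j\le m+1$, $$B_i^{-1}B_j = B_j B_i^{-1}.$$
   Context: Let $m\ge 1$ be an integer and let $d_1,\dots,d_{m+1}$ and $n_1,\dots,n_{m+1}$ be nonzero real numbers. Define $m\times m$ real triangular Toeplitz matrices as follows. $D_L$ is lower triangular with $(p,q)$ entry $d_{p-q+1}$ if $p\ge q$ and $0$ if $p<q$ (so $d_1$ is on the diagonal and the first column is $(d_1,\dots,d_m)^T$). $D_U$ is upper triangular with $(p,q)$ entry $d_{m+1-(q-p)}$ if $q\ge p$ and $0$ if $q<p$ (so $d_{m+1}$ is on the diagonal and the first row is $(d_{m+1},d_m,\dots,d_2)$). $N_L$ and $N_U$ are defined in the same way with $n_k$ in place of $d_k$. Define the $2m\times 2m$ block matrices $$S=\begin{pmatrix} D_L & N_L\\ D_U & N_U\end{pmatrix},\qquad D=\begin{pmatrix} D_L & 0\\ D_U & D_L\end{pmatrix}.$$ The numbers $d_k,n_k$ are assumed to be such that both $S$ and $D$ are invertible. Put $B=S^{-1}$ and let $B_B$ be the $m\times 2m$ matrix consisting of the last $m$ rows of $B$. For $1\le i\le m+1$, $B_i$ denotes the $m\times m$ submatrix of $B_B$ consisting of its $m$ consecutive columns $i,i+1,\dots,i+m-1$. Under these assumptions every $B_i$ is invertible, so $B_i^{-1}$ makes sense. *)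

theory Defs
  imports Complex_Main "Jordan_Normal_Form.Gauss_Jordan_Elimination"
begin

text \<open>
  Matrix positions are 0-based, so the position \<open>(p, q)\<close> below is the position \<open>(p + 1, q + 1)\<close> in
  1-based notation. The sequences \<open>d\<close>, \<open>n\<close> are kept 1-based: of \<open>a :: nat \<Rightarrow> real\<close> only the values
  \<open>a 1, \<dots>, a (m + 1)\<close> are used, and the truncated subtractions below never truncate.
\<close>

definition toep_lower :: "nat \<Rightarrow> (nat \<Rightarrow> real) \<Rightarrow> real mat" where
  "toep_lower m a = mat m m (\<lambda>(p, q). if q \<le> p then a (p - q + 1) else 0)"

definition toep_upper :: "nat \<Rightarrow> (nat \<Rightarrow> real) \<Rightarrow> real mat" where
  "toep_upper m a = mat m m (\<lambda>(p, q). if p \<le> q then a (m + 1 - (q - p)) else 0)"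

definition S_mat :: "nat \<Rightarrow> (nat \<Rightarrow> real) \<Rightarrow> (nat \<Rightarrow> real) \<Rightarrow> real mat" where
  "S_mat m d n = four_block_mat (toep_lower m d) (toep_lower m n)
                                (toep_upper m d) (toep_upper m n)"

definition D_mat :: "nat \<Rightarrow> (nat \<Rightarrow> real) \<Rightarrow> real mat" where
  "D_mat m d = four_block_mat (toep_lower m d) (0\<^sub>m m m)
                              (toep_upper m d) (toep_lower m d)"

text \<open>
  The inverse as a total function; it is meaningful only on invertible matrices, where it is
  the two-sided inverse (lemma \<open>mat_inv\<close>).
\<close>

definition mat_inv :: "real mat \<Rightarrow> real mat" where
  "mat_inv A = the (mat_inverse A)"

lemma mat_inv:
  assumes A: "A \<in> carrier_mat k k" and inv: "invertible_mat A"
  shows "mat_inv A \<in> carrier_mat k k"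
    and "A * mat_inv A = 1\<^sub>m k"
    and "mat_inv A * A = 1\<^sub>m k"
proof -
  from inv obtain X where AX: "A * X = 1\<^sub>m (dim_row A)" and XA: "X * A = 1\<^sub>m (dim_row X)"
    unfolding invertible_mat_def inverts_mat_def by blast
  have "dim_col (A * X) = k" "dim_col (X * A) = dim_row X" using A AX XA by simp_all
  hence X: "X \<in> carrier_mat k k" using A by auto
  have "A \<in> Units (ring_mat TYPE(real) k ())"
    unfolding Units_def ring_mat_simps using A X AX XA by auto
  with mat_inverse(1)[OF A, of "()"] obtain Y where Y: "mat_inverse A = Some Y"
    by (cases "mat_inverse A") auto
  from mat_inverse(2)[OF A Y] Y
  show "mat_inv A \<in> carrier_mat k k" "A * mat_inv A = 1\<^sub>m k" "mat_inv A * A = 1\<^sub>m k"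
    unfolding mat_inv_def by simp_all
qed

definition B_bottom :: "nat \<Rightarrow> (nat \<Rightarrow> real) \<Rightarrow> (nat \<Rightarrow> real) \<Rightarrow> real mat" where
  "B_bottom m d n = mat m (2 * m) (\<lambda>(p, q). mat_inv (S_mat m d n) $$ (m + p, q))"

text \<open>Here \<open>i\<close> is the 1-based index of the first column, \<open>1 \<le> i \<le> m + 1\<close>.\<close>

definition B_sub :: "nat \<Rightarrow> (nat \<Rightarrow> real) \<Rightarrow> (nat \<Rightarrow> real) \<Rightarrow> nat \<Rightarrow> real mat" where
  "B_sub m d n i = mat m m (\<lambda>(p, q). B_bottom m d n $$ (p, i - 1 + q))"

end

theory Submission
  imports Defs "Jordan_Normal_Form.Determinant"
begin

text \<open>
  Identify the columns of length \<open>2 * m\<close> with the polynomials of degree \<open>< 2 * m\<close>. Then \<open>S\<close> sends a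
  pair \<open>(x, y)\<close> of polynomials of degree \<open>< m\<close> to \<open>d x + n y\<close>, so the last \<open>m\<close> rows of its inverse
  send \<open>f\<close> to the residue of \<open>f / n\<close> modulo \<open>d\<close>. Hence \<open>B\<^sub>i\<close> is the matrix of multiplication by
  \<open>t\<^bsup>i-1\<^esup> / n\<close> on \<open>\<real>[t] / (d)\<close>, that is \<open>B\<^sub>i = B\<^sub>1 C\<^bsup>i-1\<^esup>\<close> with \<open>C\<close> the companion matrix of \<open>d\<close> and
  \<open>B\<^sub>1 = n(C)\<^bsup>-1\<^esup>\<close>. All these matrices commute, and \<open>C\<close> is invertible because \<open>d\<close> does not vanish at 0.
\<close>

section \<open>Inverses and commutation of square matrices\<close>

lemma invertible_matI_right_inverse:
  fixes A X :: "'a :: field mat"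
  assumes "A \<in> carrier_mat m m" "X \<in> carrier_mat m m" "A * X = 1\<^sub>m m"
  shows "invertible_mat A"
proof -
  have "X * A = 1\<^sub>m m" using mat_mult_left_right_inverse[OF assms] .
  with assms show ?thesis
    unfolding invertible_mat_def inverts_mat_def by (auto simp: square_mat.simps)
qed

lemma inverse_commutes:
  fixes A X Y :: "'a :: semiring_1 mat"
  assumes A: "A \<in> carrier_mat m m" and Y: "Y \<in> carrier_mat m m" and X: "X \<in> carrier_mat m m"
    and AY: "A * Y = 1\<^sub>m m" and YA: "Y * A = 1\<^sub>m m" and comm: "A * X = X * A"
  shows "Y * X = X * Y"
proof -
  have "Y * X = Y * (X * (A * Y))" using X Y AY by simp
  also have "\<dots> = Y * ((A * X) * Y)" unfolding comm using A X Y by (simp add: assoc_mult_mat[of _ m m _ m _ m])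
  also have "\<dots> = (Y * A) * (X * Y)" using A X Y by (simp add: assoc_mult_mat[of _ m m _ m _ m])
  also have "\<dots> = X * Y" using X Y YA by simp
  finally show ?thesis .
qed

lemma mult_commutes:
  fixes A X Y :: "'a :: semiring_1 mat"
  assumes A: "A \<in> carrier_mat m m" and X: "X \<in> carrier_mat m m" and Y: "Y \<in> carrier_mat m m"
    and AX: "A * X = X * A" and AY: "A * Y = Y * A"
  shows "A * (X * Y) = (X * Y) * A"
proof -
  have "A * (X * Y) = X * A * Y" unfolding AX[symmetric] by (rule assoc_mult_mat[OF A X Y, symmetric])
  also have "\<dots> = X * (Y * A)" unfolding AY[symmetric] by (rule assoc_mult_mat[OF X A Y])
  also have "\<dots> = (X * Y) * A" by (rule assoc_mult_mat[OF X Y A, symmetric])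
  finally show ?thesis .
qed

lemma pow_mat_commutes:
  fixes A X :: "'a :: semiring_1 mat"
  assumes A: "A \<in> carrier_mat m m" and X: "X \<in> carrier_mat m m" and comm: "A * X = X * A"
  shows "A * (X ^\<^sub>m k) = (X ^\<^sub>m k) * A"
proof (induction k)
  case 0
  then show ?case using A X by simp
next
  case (Suc k)
  then show ?case using mult_commutes[OF A pow_carrier_mat[OF X] X Suc comm] by simp
qed

lemma invertible_mat_mult:
  fixes A X :: "real mat"
  assumes A: "A \<in> carrier_mat m m" "invertible_mat A" and X: "X \<in> carrier_mat m m" "invertible_mat X"
  shows "invertible_mat (A * X)"
proof (rule invertible_matI_right_inverse)
  note Ai = mat_inv[OF A] and Xi = mat_inv[OF X]
  show "A * X \<in> carrier_mat m m" "mat_inv X * mat_inv A \<in> carrier_mat m m"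
    using A X Ai Xi by simp_all
  have "A * X * (mat_inv X * mat_inv A) = A * ((X * mat_inv X) * mat_inv A)"
    using A(1) X(1) Ai(1) Xi(1) by (simp add: assoc_mult_mat[of _ m m _ m _ m])
  also have "\<dots> = 1\<^sub>m m" using A(1) Ai Xi by simp
  finally show "A * X * (mat_inv X * mat_inv A) = 1\<^sub>m m" .
qed

lemma invertible_mat_pow:
  fixes A :: "real mat"
  assumes A: "A \<in> carrier_mat m m" "invertible_mat A"
  shows "invertible_mat (A ^\<^sub>m k)"
proof (induction k)
  case 0
  show ?case using A(1) by (intro invertible_matI_right_inverse[of _ m "1\<^sub>m m"]) simp_all
next
  case (Suc k)
  then show ?case using invertible_mat_mult[OF pow_carrier_mat[OF A(1)] Suc A] by simp
qed

section \<open>Linear combinations of matrices\<close>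

text \<open>Serves to form the matrix polynomial n(C), with the powers of the companion matrix as
  \<open>F\<close>.\<close>

definition mat_comb :: "nat \<Rightarrow> nat \<Rightarrow> (nat \<Rightarrow> real) \<Rightarrow> (nat \<Rightarrow> real mat) \<Rightarrow> real mat" where
  "mat_comb m K a F = mat m m (\<lambda>(r, c). \<Sum>k\<le>K. a k * F k $$ (r, c))"

lemma mat_comb_carrier [simp]: "mat_comb m K a F \<in> carrier_mat m m"
  by (simp add: mat_comb_def)

lemma mat_comb_cong:
  assumes "\<And>k. k \<le> K \<Longrightarrow> F k = G k"
  shows "mat_comb m K a F = mat_comb m K a G"
  using assms by (auto simp: mat_comb_def)

lemma mult_mat_comb:
  assumes A: "A \<in> carrier_mat m m" and F: "\<And>k. F k \<in> carrier_mat m m"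
  shows "A * mat_comb m K a F = mat_comb m K a (\<lambda>k. A * F k)"
proof (rule eq_matI)
  have F': "dim_row (F k) = m" "dim_col (F k) = m" for k using F[of k] by auto
  fix r c assume "r < dim_row (mat_comb m K a (\<lambda>k. A * F k))" "c < dim_col (mat_comb m K a (\<lambda>k. A * F k))"
  then have rc: "r < m" "c < m" by (simp_all add: mat_comb_def)
  have "(\<Sum>s = 0..<m. A $$ (r, s) * (\<Sum>k\<le>K. a k * F k $$ (s, c)))
      = (\<Sum>k\<le>K. a k * (\<Sum>s = 0..<m. A $$ (r, s) * F k $$ (s, c)))"
    unfolding sum_distrib_left by (subst sum.swap) (simp add: ac_simps)
  then show "(A * mat_comb m K a F) $$ (r, c) = mat_comb m K a (\<lambda>k. A * F k) $$ (r, c)"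
    using A rc by (simp add: mat_comb_def scalar_prod_def F')
qed (use A in \<open>auto simp: mat_comb_def\<close>)

lemma mat_comb_mult:
  assumes A: "A \<in> carrier_mat m m" and F: "\<And>k. F k \<in> carrier_mat m m"
  shows "mat_comb m K a F * A = mat_comb m K a (\<lambda>k. F k * A)"
proof (rule eq_matI)
  have F': "dim_row (F k) = m" "dim_col (F k) = m" for k using F[of k] by auto
  fix r c assume "r < dim_row (mat_comb m K a (\<lambda>k. F k * A))" "c < dim_col (mat_comb m K a (\<lambda>k. F k * A))"
  then have rc: "r < m" "c < m" by (simp_all add: mat_comb_def)
  have "(\<Sum>s = 0..<m. (\<Sum>k\<le>K. a k * F k $$ (r, s)) * A $$ (s, c))
      = (\<Sum>k\<le>K. a k * (\<Sum>s = 0..<m. F k $$ (r, s) * A $$ (s, c)))"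
    unfolding sum_distrib_left sum_distrib_right by (subst sum.swap) (simp add: ac_simps)
  then show "(mat_comb m K a F * A) $$ (r, c) = mat_comb m K a (\<lambda>k. F k * A) $$ (r, c)"
    using A rc by (simp add: mat_comb_def scalar_prod_def F')
qed (use A in \<open>auto simp: mat_comb_def\<close>)

section \<open>The companion matrix of \<open>d\<close>\<close>

text \<open>Multiplication by t in the basis 1, t, ..., t^(m-1); the last column is the reduction of
  t^m modulo d, whose leading coefficient is \<open>d (m + 1)\<close>.\<close>

definition companion :: "nat \<Rightarrow> (nat \<Rightarrow> real) \<Rightarrow> real mat" where
  "companion m d = mat m m (\<lambda>(r, c).
     if Suc c < m then (if r = Suc c then 1 else 0) else - d (Suc r) / d (m + 1))"

lemma companion_carrier [simp]: "companion m d \<in> carrier_mat m m"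
  by (simp add: companion_def)

text \<open>All columns of the companion matrix but the last are unit vectors, so the product shifts
  the columns of \<open>A\<close> one place to the left and only its last column is new.\<close>

lemma mult_companion_index:
  assumes A: "A \<in> carrier_mat m m" and rc: "r < m" "c < m"
  shows "(A * companion m d) $$ (r, c) =
    (if Suc c < m then A $$ (r, Suc c) else - (\<Sum>s<m. d (Suc s) * A $$ (r, s)) / d (m + 1))"
proof -
  have "(A * companion m d) $$ (r, c) = (\<Sum>s<m. A $$ (r, s) * companion m d $$ (s, c))"
    using A rc by (simp add: scalar_prod_def companion_def atLeast0LessThan)
  also have "\<dots> = (if Suc c < m then A $$ (r, Suc c)
      else - (\<Sum>s<m. d (Suc s) * A $$ (r, s)) / d (m + 1))"
    using rc by (auto simp: companion_def if_distrib[of "\<lambda>x. _ * x"] sum_divide_distrib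
        sum_negf[symmetric] ac_simps cong: if_cong intro!: sum.cong)
  finally show ?thesis .
qed

text \<open>The inverse is multiplication by \<open>1 / t\<close> modulo \<open>d\<close>: it sends \<open>1\<close> to
  \<open>- (\<Sum>k \<ge> 1. d\<^bsub>k+1\<^esub> t\<^bsup>k-1\<^esup>) / d\<^sub>1\<close>.\<close>

lemma invertible_companion:
  assumes d: "d 1 \<noteq> 0" "d (m + 1) \<noteq> 0"
  shows "invertible_mat (companion m d)"
proof -
  define E where "E = mat m m (\<lambda>(r, c).
    if c = 0 then - d (r + 2) / d 1 else if c = Suc r then 1 else 0)"
  have E: "E \<in> carrier_mat m m" by (simp add: E_def)
  have "E * companion m d = 1\<^sub>m m"
  proof (rule eq_matI)
    fix r c assume "r < dim_row (1\<^sub>m m)" "c < dim_col (1\<^sub>m m)"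
    then have rc: "r < m" "c < m" by simp_all
    then obtain k where m: "m = Suc k" by (cases m) auto
    \<comment> \<open>The first term comes from column 0 of \<open>E\<close>, the second from the
      entry 1 in column \<open>Suc r\<close>. They cancel except in the last row, which has no such
      column.\<close>
    have "(\<Sum>s<m. d (Suc s) * E $$ (r, s)) = - d (r + 2) + (\<Sum>s<k. if s = r then d (r + 2) else 0)"
      unfolding m sum.lessThan_Suc_shift using rc d
      by (auto simp: E_def m if_distrib[of "\<lambda>x. _ * x"] cong: if_cong)
    also have "\<dots> = (if Suc r = m then - d (m + 1) else 0)"
      using rc m by (auto simp: sum.delta)
    finally show "(E * companion m d) $$ (r, c) = 1\<^sub>m m $$ (r, c)"
      unfolding mult_companion_index[OF E rc] using rc d by (auto simp: E_def)
  qed (use E in \<open>auto simp: companion_def\<close>)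
  then have "companion m d * E = 1\<^sub>m m"
    by (rule mat_mult_left_right_inverse[OF E companion_carrier])
  then show ?thesis using E by (intro invertible_matI_right_inverse[of _ m E]) simp_all
qed

section \<open>The Sylvester structure of \<open>S_mat\<close> and the rows of its inverse\<close>

lemma S_mat_carrier [simp]: "S_mat m d n \<in> carrier_mat (2 * m) (2 * m)"
  unfolding S_mat_def mult_2 by (intro four_block_carrier_mat) (simp_all add: toep_lower_def toep_upper_def)

text \<open>In each block column the lower and the upper Toeplitz block join into one band: columns
  \<open>q\<close> and \<open>m + q\<close> list the coefficients of t^q d and t^q n.\<close>

lemma S_mat_index:
  assumes "l < 2 * m" "q < m"
  shows "S_mat m d n $$ (l, q) = (if l \<in> {q..q + m} then d (l - q + 1) else 0)"
    and "S_mat m d n $$ (l, m + q) = (if l \<in> {q..q + m} then n (l - q + 1) else 0)"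
  using assms
  by (auto simp: S_mat_def toep_lower_def toep_upper_def Suc_diff_le not_le intro!: arg_cong[of _ _ d] arg_cong[of _ _ n])

text \<open>These are the entries of \<open>mat_inv (S_mat m d n) * S_mat m d n\<close> in row
  \<open>m + p\<close> and columns \<open>q\<close> and \<open>m + q\<close>. In polynomial terms,
  t^q d is sent to 0 and t^q n to t^q.\<close>

lemma B_bottom_convolution:
  assumes inv: "invertible_mat (S_mat m d n)" and p: "p < m" and q: "q < m"
  shows "(\<Sum>k\<le>m. d (Suc k) * B_bottom m d n $$ (p, q + k)) = 0"
    and "(\<Sum>k\<le>m. n (Suc k) * B_bottom m d n $$ (p, q + k)) = (if p = q then 1 else 0)"
proof -
  note B = mat_inv[OF S_mat_carrier inv]
  have entry: "(\<Sum>k\<le>m. a (Suc k) * B_bottom m d n $$ (p, q + k)) = 1\<^sub>m (2 * m) $$ (m + p, c)"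
    if c: "c < 2 * m"
      and col: "\<And>l. l < 2 * m \<Longrightarrow> S_mat m d n $$ (l, c) = (if l \<in> {q..q + m} then a (l - q + 1) else 0)"
    for a c
  proof -
    have dims: "dim_row (mat_inv (S_mat m d n)) = 2 * m" "dim_col (mat_inv (S_mat m d n)) = 2 * m"
      "dim_row (S_mat m d n) = 2 * m" "dim_col (S_mat m d n) = 2 * m"
      using carrier_matD[OF B(1)] carrier_matD[OF S_mat_carrier] by simp_all
    have "1\<^sub>m (2 * m) $$ (m + p, c) = (mat_inv (S_mat m d n) * S_mat m d n) $$ (m + p, c)"
      using B by simp
    also have "\<dots> = (\<Sum>l<2 * m. B_bottom m d n $$ (p, l) * S_mat m d n $$ (l, c))"
      using p c dims by (simp add: scalar_prod_def B_bottom_def atLeast0LessThan)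
    also have "\<dots> = (\<Sum>l<2 * m. if l \<in> {q..q + m} then B_bottom m d n $$ (p, l) * a (l - q + 1) else 0)"
      by (intro sum.cong) (auto simp: col)
    also have "\<dots> = (\<Sum>l\<in>{..<2 * m} \<inter> {q..q + m}. B_bottom m d n $$ (p, l) * a (l - q + 1))"
      by (simp only: sum.inter_restrict finite_lessThan)
    also have "{..<2 * m} \<inter> {q..q + m} = {q..q + m}" using q by auto
    also have "(\<Sum>l\<in>{q..q + m}. B_bottom m d n $$ (p, l) * a (l - q + 1))
        = (\<Sum>k\<le>m. a (Suc k) * B_bottom m d n $$ (p, q + k))"
      by (rule sum.reindex_bij_witness[of _ "\<lambda>k. q + k" "\<lambda>l. l - q"]) auto
    finally show ?thesis by simp
  qed
  show "(\<Sum>k\<le>m. d (Suc k) * B_bottom m d n $$ (p, q + k)) = 0"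
    using entry[of q d] S_mat_index(1)[OF _ q] p q by simp
  show "(\<Sum>k\<le>m. n (Suc k) * B_bottom m d n $$ (p, q + k)) = (if p = q then 1 else 0)"
    using entry[of "m + q" n] S_mat_index(2)[OF _ q] p q by simp
qed

section \<open>The blocks as products with powers of the companion matrix\<close>

lemma B_sub_carrier [simp]: "B_sub m d n i \<in> carrier_mat m m"
  by (simp add: B_sub_def)

text \<open>Both sides move the window of columns one step to the right. The column that enters is
  determined by the preceding \<open>m\<close> through the convolution identity for
  \<open>d\<close>.\<close>

lemma B_sub_mult_companion:
  assumes inv: "invertible_mat (S_mat m d n)" and d: "d (m + 1) \<noteq> 0" and k: "k < m"
  shows "B_sub m d n (Suc k) * companion m d = B_sub m d n (Suc (Suc k))"
proof (rule eq_matI)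
  fix r c assume "r < dim_row (B_sub m d n (Suc (Suc k)))" "c < dim_col (B_sub m d n (Suc (Suc k)))"
  then have rc: "r < m" "c < m" by (simp_all add: B_sub_def)
  have "(\<Sum>s<m. d (Suc s) * B_bottom m d n $$ (r, k + s)) = - d (m + 1) * B_bottom m d n $$ (r, k + m)"
    using B_bottom_convolution(1)[OF inv rc(1) k] by (simp add: lessThan_Suc_atMost[symmetric])
  \<comment> \<open>Here \<open>c\<close> is the last column, and \<open>k + m\<close> is the
    0-based position in \<open>B_bottom\<close> of the entering column.\<close>
  moreover have "k + m = Suc (k + c)" if "\<not> Suc c < m" using that rc by simp
  ultimately show "(B_sub m d n (Suc k) * companion m d) $$ (r, c) = B_sub m d n (Suc (Suc k)) $$ (r, c)"
    unfolding mult_companion_index[OF B_sub_carrier rc] using rc d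
    by (cases "Suc c < m") (simp_all add: B_sub_def)
qed (auto simp: B_sub_def companion_def)

lemma B_sub_eq_mult_pow:
  assumes inv: "invertible_mat (S_mat m d n)" and d: "d (m + 1) \<noteq> 0" and "k \<le> m"
  shows "B_sub m d n (Suc k) = B_sub m d n 1 * companion m d ^\<^sub>m k"
  using \<open>k \<le> m\<close>
proof (induction k)
  case 0
  have "B_sub m d n 1 * 1\<^sub>m m = B_sub m d n 1" by (rule right_mult_one_mat[OF B_sub_carrier])
  then show ?case by (simp add: companion_def)
next
  case (Suc k)
  then have "B_sub m d n (Suc (Suc k)) = B_sub m d n 1 * companion m d ^\<^sub>m k * companion m d"
    using B_sub_mult_companion[OF inv d, of k] by simp
  then show ?case by (simp add: assoc_mult_mat[of _ m m _ m _ m] pow_carrier_mat)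
qed

text \<open>Multiplying out turns the left side into the combination of the blocks with coefficients
  \<open>n (Suc k)\<close>, whose entries are the convolution identity for \<open>n\<close>. This
  also yields the invertibility of the first block.\<close>

lemma B_sub_1_mult_poly:
  assumes inv: "invertible_mat (S_mat m d n)" and d: "d (m + 1) \<noteq> 0"
  shows "B_sub m d n 1 * mat_comb m m (\<lambda>k. n (Suc k)) (\<lambda>k. companion m d ^\<^sub>m k) = 1\<^sub>m m"
proof -
  have "B_sub m d n 1 * mat_comb m m (\<lambda>k. n (Suc k)) (\<lambda>k. companion m d ^\<^sub>m k)
      = mat_comb m m (\<lambda>k. n (Suc k)) (\<lambda>k. B_sub m d n (Suc k))"
    by (subst mult_mat_comb[OF B_sub_carrier])
      (auto intro!: pow_carrier_mat mat_comb_cong B_sub_eq_mult_pow[OF inv d, symmetric] simp del: One_nat_def)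
  also have "\<dots> = 1\<^sub>m m"
  proof (rule eq_matI)
    fix r c assume "r < dim_row (1\<^sub>m m)" "c < dim_col (1\<^sub>m m)"
    then have rc: "r < m" "c < m" by simp_all
    then show "mat_comb m m (\<lambda>k. n (Suc k)) (\<lambda>k. B_sub m d n (Suc k)) $$ (r, c) = 1\<^sub>m m $$ (r, c)"
      using B_bottom_convolution(2)[OF inv rc] by (simp add: mat_comb_def B_sub_def add.commute)
  qed (simp_all add: mat_comb_def)
  finally show ?thesis .
qed

text \<open>The first block is the inverse of \<open>?P\<close>, a polynomial in the companion
  matrix, and so commutes with whatever \<open>?P\<close> commutes with.\<close>

lemma B_sub_1_companion_commute:
  assumes inv: "invertible_mat (S_mat m d n)" and d: "d (m + 1) \<noteq> 0"
  shows "B_sub m d n 1 * companion m d = companion m d * B_sub m d n 1"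
proof -
  let ?C = "companion m d" and ?P = "mat_comb m m (\<lambda>k. n (Suc k)) (\<lambda>k. companion m d ^\<^sub>m k)"
  have PC: "?P * ?C = ?C * ?P"
    using pow_mat_commutes[OF companion_carrier companion_carrier refl, of m d]
    by (simp add: mult_mat_comb mat_comb_mult pow_carrier_mat)
  note BP = B_sub_1_mult_poly[OF assms]
  have PB: "?P * B_sub m d n 1 = 1\<^sub>m m"
    by (rule mat_mult_left_right_inverse[OF B_sub_carrier mat_comb_carrier BP])
  show ?thesis
    by (rule inverse_commutes[OF mat_comb_carrier B_sub_carrier companion_carrier PB BP PC])
qed

theorem theorem1p3:
  fixes m i j :: nat and d n :: "nat \<Rightarrow> real"
  assumes "1 \<le> m"
    and "\<And>k. 1 \<le> k \<Longrightarrow> k \<le> m + 1 \<Longrightarrow> d k \<noteq> 0"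
    and "\<And>k. 1 \<le> k \<Longrightarrow> k \<le> m + 1 \<Longrightarrow> n k \<noteq> 0"
    and "invertible_mat (S_mat m d n)"
    and "invertible_mat (D_mat m d)"
    and "1 \<le> i" and "i < j" and "j \<le> m + 1"
  shows "mat_inv (B_sub m d n i) * B_sub m d n j = B_sub m d n j * mat_inv (B_sub m d n i)"
proof -
  let ?C = "companion m d" and ?B = "B_sub m d n"
  have d: "d 1 \<noteq> 0" "d (m + 1) \<noteq> 0" using assms(2) by simp_all
  note inv = assms(4)
  obtain a b where i: "i = Suc a" and j: "j = Suc b" using assms(6,7) by (cases i; cases j) auto
  have Bi: "?B i = ?B 1 * ?C ^\<^sub>m a" and Bj: "?B j = ?B 1 * ?C ^\<^sub>m b"
    using assms(7,8) unfolding i j by (auto intro!: B_sub_eq_mult_pow[OF inv d(2)] simp del: One_nat_def)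
  have pow: "?C ^\<^sub>m k \<in> carrier_mat m m" for k by (simp add: pow_carrier_mat)
  have B1: "invertible_mat (?B 1)"
    by (rule invertible_matI_right_inverse[OF _ _ B_sub_1_mult_poly[OF inv d(2)]]) simp_all
  have inv_i: "invertible_mat (?B i)"
    unfolding Bi by (rule invertible_mat_mult[OF B_sub_carrier B1 pow
      invertible_mat_pow[OF companion_carrier invertible_companion[OF d]]])
  have B1_C: "?B 1 * ?C = ?C * ?B 1" by (rule B_sub_1_companion_commute[OF inv d(2)])
  note B1_pow = pow_mat_commutes[OF B_sub_carrier companion_carrier B1_C]
  have C_Bi: "?C * ?B i = ?B i * ?C"
    unfolding Bi
    by (rule mult_commutes[OF companion_carrier B_sub_carrier pow B1_C[symmetric]
      pow_mat_commutes[OF companion_carrier companion_carrier refl]])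
  have B1_Bi: "?B 1 * ?B i = ?B i * ?B 1"
    unfolding Bi by (rule mult_commutes[OF B_sub_carrier B_sub_carrier pow refl B1_pow])
  \<comment> \<open>\<open>?B i\<close> commutes with both \<open>?B 1\<close> and
    \<open>?C\<close>, hence with the product \<open>?B 1 * ?C ^\<^sub>m b\<close>.\<close>
  have "?B i * ?B j = ?B j * ?B i"
    unfolding Bj
    by (rule mult_commutes[OF B_sub_carrier B_sub_carrier pow B1_Bi[symmetric]
      pow_mat_commutes[OF B_sub_carrier companion_carrier C_Bi[symmetric]]])
  then show ?thesis
    by (rule inverse_commutes[OF B_sub_carrier mat_inv(1)[OF B_sub_carrier inv_i] B_sub_carrier
      mat_inv(2,3)[OF B_sub_carrier inv_i]])
qed

end
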